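(* Let $\xi$ be a symmetric integrable random vector in $\mathbb{R}^d$, not almost surely zero, and let $\varepsilon$ be any random variable with values $\pm1$ (defined on the same probability space as $\xi$ and possibly dependent on $\xi$). Then the values $$\mathbf{E}\,|u_0\varepsilon+\langle u,\xi\rangle|,\qquad u_0\in\mathbb{R},\ u\in\mathbb{R}^d,$$ determine uniquely the distribution of $\xi$. That is, if $\xi,\xi^*$ are two such symmetric random vectors and $\varepsilon,\varepsilon^*$ are two such $\{-1,1\}$-valued random variables with $\mathbf{E}|u_0\varepsilon+\langle u,\xi\rangle|=\mathbf{E}|u_0\varepsilon^*+\langle u,\xi^*\rangle|$ for all $u_0\in\mathbb{R}$ and $u\in\mathbb{R}^d$, then $\xi$ and $\xi^*$ have the same distribution.
   Context: A random vector $\xi$ is symmetric if $\xi$ and $-\xi$ have the same distribution. The pairs $(\varepsilon,\xi)$ and $(\varepsilon^*,\xi^* )$ may be defined on different probability spaces. *)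

theory Defs
  imports "HOL-Probability.Probability"
begin

definition symmetric_random_vector ::
    "'a measure \<Rightarrow> ('a \<Rightarrow> 'b :: euclidean_space) \<Rightarrow> bool" where
  "symmetric_random_vector M \<xi> \<longleftrightarrow>
     \<xi> \<in> borel_measurable M \<and>
     distr M borel \<xi> = distr M borel (\<lambda>\<omega>. - \<xi> \<omega>)"

end

theory Submission
  imports Defs
begin

text \<open>
  Since \<open>\<bar>\<epsilon>\<bar> = 1\<close>, the given values are \<open>E \<bar>u\<^sub>0 + \<langle>u, \<epsilon>\<xi>\<rangle>\<bar>\<close>; their left derivatives in \<open>u\<^sub>0\<close> give the
  distribution functions of all \<open>\<langle>u, \<epsilon>\<xi>\<rangle>\<close>, hence \<open>E cos \<langle>u, \<epsilon>\<xi>\<rangle> = E cos \<langle>u, \<xi>\<rangle>\<close>. By symmetry of \<open>\<xi>\<close>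
  this is its characteristic function. Uniqueness of multivariate characteristic functions follows
  from the Stone-Weierstrass theorem: every polynomial in the coordinates \<open>n sin(\<xi>\<^sub>i / n)\<close> is a
  trigonometric polynomial in \<open>\<xi>\<close>, these coordinates are bounded, and they tend to \<open>\<xi>\<^sub>i\<close>.
\<close>

section \<open>Probability measures determined by bounded continuous functions\<close>

text \<open>The closed sets are an intersection-stable generator of the Borel sets, and the
  indicator of a nonempty closed set is a bounded pointwise limit of continuous functions of the
  distance to it.\<close>

lemma measure_eqI_integral_bounded_continuous:
  fixes P Q :: "'a::metric_space measure"
  assumes P: "prob_space P" "sets P = sets borel" and Q: "prob_space Q" "sets Q = sets borel"
    and eq: "\<And>g :: 'a \<Rightarrow> real. continuous_on UNIV g \<Longrightarrow> bounded (range g) \<Longrightarrow>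
               integral\<^sup>L P g = integral\<^sup>L Q g"
  shows "P = Q"
proof -
  interpret P: prob_space P by fact
  interpret Q: prob_space Q by fact
  have *: "emeasure P C = emeasure Q C" if C: "closed C" for C
  \<comment> \<open>The empty set is split off because \<open>infdist x {}\<close> is 0 by
    convention, which would make every \<open>g n\<close> constantly 1.\<close>
  proof (cases "C = {}")
    case False
    define g where "g n x = max 0 (1 - real n * infdist x C)" for n x
    have cont: "continuous_on UNIV (g n)" for n
      unfolding g_def by (intro continuous_intros)
    have g01: "0 \<le> g n x" "g n x \<le> 1" for n x
      by (auto simp: g_def infdist_nonneg)
    have bdd: "bounded (range (g n))" for n
      using g01 by (intro boundedI[of _ 1]) auto
    have lim: "(\<lambda>n. g n x) \<longlonglongrightarrow> indicator C x" for x
    proof (cases "x \<in> C")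
      case True
      then show ?thesis by (simp add: g_def)
    next
      case x: False
      then have pos: "infdist x C > 0"
        using C False by (metis in_closed_iff_infdist_zero infdist_nonneg less_eq_real_def)
      then obtain m where m: "1 < real m * infdist x C"
        using reals_Archimedean3 by blast
      have "g n x = 0" if "n \<ge> m" for n
      proof -
        have "real m * infdist x C \<le> real n * infdist x C"
          using that pos by (intro mult_right_mono) auto
        then show ?thesis using m by (simp add: g_def)
      qed
      then have "eventually (\<lambda>n. g n x = indicator C x) sequentially"
        using x by (auto simp: eventually_sequentially)
      then show ?thesis by (rule tendsto_eventually)
    qed
    have limint: "(\<lambda>n. integral\<^sup>L R (g n)) \<longlonglongrightarrow> measure R C"
      if R: "prob_space R" "sets R = sets borel" for R
    proof -
      interpret R: prob_space R by fact
      have "(\<lambda>n. integral\<^sup>L R (g n)) \<longlonglongrightarrow> integral\<^sup>L R (indicator C)"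
      proof (rule integral_dominated_convergence[where w = "\<lambda>_. 1"])
        show "indicator C \<in> borel_measurable R"
          using C R by (intro borel_measurable_indicator) auto
        show "g n \<in> borel_measurable R" for n
          using borel_measurable_continuous_onI[OF cont[of n]] R(2)
          by (simp cong: measurable_cong_sets)
      qed (use lim g01 in auto)
      moreover have "integral\<^sup>L R (indicator C) = measure R C"
        using C R by (subst Bochner_Integration.integral_indicator) (auto simp: R.emeasure_eq_measure)
      ultimately show ?thesis by simp
    qed
    have "measure P C = measure Q C"
      using limint[OF P] limint[OF Q] eq[OF cont bdd] LIMSEQ_unique by auto
    then show ?thesis
      by (simp add: P.emeasure_eq_measure Q.emeasure_eq_measure)
  qed simp
  show ?thesis
  proof (rule measure_eqI_generator_eq[where E = "{C. closed C}" and \<Omega> = UNIV and A = "\<lambda>_. UNIV"])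
    show "sets P = sigma_sets UNIV {C. closed C}" "sets Q = sigma_sets UNIV {C. closed C}"
      using P Q by (simp_all add: borel_eq_closed)
  qed (auto simp: Int_stable_def *)
qed

section \<open>The algebra of trigonometric polynomials\<close>

text \<open>The phase \<open>c\<close> lets one kind of generator cover sines, cosines and
  constants. Products have no rule of their own, so that an induction only has to treat single
  cosines and sums.\<close>

inductive trig_polynomial :: "('a::real_inner \<Rightarrow> real) \<Rightarrow> bool" where
  cos: "trig_polynomial (\<lambda>x. a * cos (u \<bullet> x + c))"
| add: "trig_polynomial f \<Longrightarrow> trig_polynomial g \<Longrightarrow> trig_polynomial (\<lambda>x. f x + g x)"

lemma trig_polynomial_const: "trig_polynomial (\<lambda>x. a)"
  using trig_polynomial.cos[of a 0 0] by simp

text \<open>The product-to-sum formula turns a product of cosines with frequencies \<open>u\<close>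
  and \<open>v\<close> into cosines with frequencies \<open>u - v\<close> and
  \<open>u + v\<close>.\<close>

lemma trig_polynomial_mult_cos:
  assumes "trig_polynomial f"
  shows "trig_polynomial (\<lambda>x. f x * (b * cos (v \<bullet> x + d)))"
  using assms
proof induction
  case (cos a u c)
  have "(\<lambda>x. a * cos (u \<bullet> x + c) * (b * cos (v \<bullet> x + d))) =
    (\<lambda>x. a * b / 2 * cos ((u - v) \<bullet> x + (c - d)) + a * b / 2 * cos ((u + v) \<bullet> x + (c + d)))"
  proof
    fix x
    have "cos (u \<bullet> x + c) * cos (v \<bullet> x + d) =
       (cos ((u \<bullet> x + c) - (v \<bullet> x + d)) + cos ((u \<bullet> x + c) + (v \<bullet> x + d))) / 2"
      by (rule cos_times_cos)
    also have "(u \<bullet> x + c) - (v \<bullet> x + d) = (u - v) \<bullet> x + (c - d)"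
      by (simp add: inner_diff_left)
    also have "(u \<bullet> x + c) + (v \<bullet> x + d) = (u + v) \<bullet> x + (c + d)"
      by (simp add: inner_add_left)
    finally show "a * cos (u \<bullet> x + c) * (b * cos (v \<bullet> x + d)) =
      a * b / 2 * cos ((u - v) \<bullet> x + (c - d)) + a * b / 2 * cos ((u + v) \<bullet> x + (c + d))"
      by (simp only: mult.assoc mult.left_commute[of _ b]) (simp add: field_simps)
  qed
  then show ?case
    by (simp only:) (intro trig_polynomial.intros)
next
  case (add f g)
  then show ?case
    by (simp add: distrib_right trig_polynomial.add)
qed

lemma trig_polynomial_mult:
  assumes "trig_polynomial f" "trig_polynomial g"
  shows "trig_polynomial (\<lambda>x. f x * g x)"
  using assms(2)
proof induction
  case (cos b v d)
  then show ?case using assms(1) by (rule trig_polynomial_mult_cos)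
next
  case (add g h)
  then show ?case
    by (simp add: distrib_left trig_polynomial.add)
qed

lemma trig_polynomial_sum:
  "finite A \<Longrightarrow> (\<And>i. i \<in> A \<Longrightarrow> trig_polynomial (f i)) \<Longrightarrow> trig_polynomial (\<lambda>x. \<Sum>i\<in>A. f i x)"
  by (induction rule: finite_induct) (auto intro: trig_polynomial_const trig_polynomial.add)

lemma trig_polynomial_sin: "trig_polynomial (\<lambda>x. a * sin (u \<bullet> x))"
  using trig_polynomial.cos[of a u "- (pi / 2)"] by (simp add: cos_diff)

section \<open>Bounded periodic substitutes for the coordinates\<close>

text \<open>For fixed \<open>r\<close> the values stay in a compact ball, where polynomials
  approximate continuous functions uniformly; for large \<open>r\<close> the map is close to the
  identity at each point.\<close>

definition sin_coords :: "real \<Rightarrow> 'a::euclidean_space \<Rightarrow> 'a" where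
  "sin_coords r x = (\<Sum>b\<in>Basis. (r * sin (b \<bullet> x / r)) *\<^sub>R b)"

text \<open>A linear functional of \<open>sin_coords r x\<close> is a finite sum of sines of linear
  forms in \<open>x\<close>. Sums and products then stay within the algebra.\<close>

lemma trig_polynomial_polynomial_sin_coords:
  fixes p :: "'a::euclidean_space \<Rightarrow> real"
  assumes "real_polynomial_function p"
  shows "trig_polynomial (\<lambda>x. p (sin_coords r x))"
  using assms
proof induction
  case (linear f)
  then interpret bounded_linear f .
  have "(\<lambda>x. f (sin_coords r x)) = (\<lambda>x. \<Sum>b\<in>Basis. (r * f b) * sin ((b /\<^sub>R r) \<bullet> x))"
    by (auto simp: sin_coords_def sum scaleR divide_inverse mult_ac intro!: sum.cong)
  then show ?case
    by (simp only:) (intro trig_polynomial_sum trig_polynomial_sin finite_Basis)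
qed (auto intro: trig_polynomial_const trig_polynomial.add trig_polynomial_mult)

lemma norm_sin_coords_le:
  fixes x :: "'a::euclidean_space" and r :: real
  shows "norm (sin_coords r x) \<le> DIM('a) * \<bar>r\<bar>"
proof -
  have "norm (sin_coords r x) \<le> (\<Sum>b\<in>(Basis::'a set). \<bar>r\<bar>)"
    unfolding sin_coords_def
    by (intro sum_norm_le) (auto simp: abs_mult mult_left_le)
  then show ?thesis by simp
qed

lemma continuous_on_sin_coords: "continuous_on A (sin_coords r)"
  unfolding sin_coords_def divide_inverse by (intro continuous_intros)

lemma sin_coords_tendsto: "(\<lambda>n. sin_coords (real n) x) \<longlonglongrightarrow> x"
proof -
  have "(\<lambda>n. real n * sin (y / real n)) \<longlonglongrightarrow> y" for y :: real
  proof (cases "y = 0")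
    case False
    \<comment> \<open>With \<open>t = 1 / n\<close>, the term \<open>n * sin (y / n)\<close> is the
      difference quotient at 0 of \<open>sin (y * t)\<close>, whose derivative there is
      \<open>y\<close>.\<close>
    have "((\<lambda>t. sin (y * t) / t) \<longlongrightarrow> y) (at 0)"
    proof -
      have "((\<lambda>t. sin (y * t)) has_field_derivative y) (at 0)"
        by (auto intro!: derivative_eq_intros)
      then show ?thesis by (simp add: has_field_derivative_iff)
    qed
    moreover have "filterlim (\<lambda>n. inverse (real n)) (at 0) sequentially"
      unfolding filterlim_at
      \<comment> \<open>The filter \<open>at 0\<close> excludes 0 itself, and
        \<open>inverse (real 0)\<close> is 0, so the indices start at 1.\<close>
      by (auto intro!: lim_inverse_n eventually_sequentiallyI[of 1])
    ultimately have "(\<lambda>n. sin (y * inverse (real n)) / inverse (real n)) \<longlonglongrightarrow> y"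
      by (rule filterlim_compose)
    then show ?thesis by (simp add: divide_inverse mult.commute)
  qed simp
  then have "(\<lambda>n. sin_coords (real n) x) \<longlonglongrightarrow> (\<Sum>b\<in>Basis. (b \<bullet> x) *\<^sub>R b)"
    unfolding sin_coords_def by (intro tendsto_intros)
  also have "(\<Sum>b\<in>Basis. (b \<bullet> x) *\<^sub>R b) = x"
    using euclidean_representation[of x] by (simp add: inner_commute[of x])
  finally show ?thesis .
qed

section \<open>Uniqueness of multivariate characteristic functions\<close>

text \<open>The phases 0 and \<open>- (pi / 2)\<close> give the real and imaginary parts of the
  characteristic function, so the hypothesis is its equality in real form.\<close>

lemma measure_eqI_integral_cos:
  fixes P Q :: "'a::euclidean_space measure"
  assumes P: "prob_space P" "sets P = sets borel" and Q: "prob_space Q" "sets Q = sets borel"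
    and eq: "\<And>u c. (\<integral>x. cos (u \<bullet> x + c) \<partial>P) = (\<integral>x. cos (u \<bullet> x + c) \<partial>Q)"
  shows "P = Q"
proof (rule measure_eqI_integral_bounded_continuous[OF P Q])
  interpret P: prob_space P by fact
  interpret Q: prob_space Q by fact
  have integrable_bounded: "integrable R f"
    if "prob_space R" "sets R = sets borel" "continuous_on UNIV f" "\<And>x. \<bar>f x\<bar> \<le> B"
    for R and f :: "'a \<Rightarrow> real" and B
  proof -
    interpret R: prob_space R by fact
    have "f \<in> borel_measurable R"
      using borel_measurable_continuous_onI[OF that(3)] that(2) by (simp cong: measurable_cong_sets)
    then show ?thesis
      using that by (intro R.integrable_const_bound[of _ B]) auto
  qed
  \<comment> \<open>Integrability is carried through the induction because additivity of the
    integral requires it.\<close>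
  have trig: "integrable P f \<and> integrable Q f \<and> integral\<^sup>L P f = integral\<^sup>L Q f"
    if "trig_polynomial f" for f
    using that
  proof induction
    case (cos a u c)
    have "integrable R (\<lambda>x. a * cos (u \<bullet> x + c))" if "prob_space R" "sets R = sets borel" for R
      using that by (rule integrable_bounded[of R _ "\<bar>a\<bar>"])
        (auto intro!: continuous_intros simp: abs_mult mult_left_le)
    then show ?case using P Q eq by simp
  qed auto
  fix g :: "'a \<Rightarrow> real"
  assume g: "continuous_on UNIV g" "bounded (range g)"
  obtain B where B: "\<And>x. \<bar>g x\<bar> \<le> B"
    using g(2) by (auto simp: bounded_iff)
  have gs: "continuous_on UNIV (\<lambda>x. g (sin_coords r x))" for r
    by (rule continuous_on_compose2[OF g(1) continuous_on_sin_coords]) simp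
  have coords_eq: "(\<integral>x. g (sin_coords r x) \<partial>P) = (\<integral>x. g (sin_coords r x) \<partial>Q)" for r
  proof -
    \<comment> \<open>Each of the two measures contributes \<open>e / 2\<close> when
      \<open>g\<close> is replaced by a polynomial \<open>p\<close>; the integrals of
      \<open>p\<close> agree. The summand 0 matches the form of
      \<open>field_le_epsilon\<close>.\<close>
    have "\<bar>(\<integral>x. g (sin_coords r x) \<partial>P) - (\<integral>x. g (sin_coords r x) \<partial>Q)\<bar> \<le> 0 + e"
      if "e > 0" for e
    proof -
      obtain p where p: "real_polynomial_function p"
          "\<And>x. x \<in> cball 0 (DIM('a) * \<bar>r\<bar>) \<Longrightarrow> \<bar>g x - p x\<bar> < e / 2"
        by (rule Stone_Weierstrass_real_polynomial_function
              [OF compact_cball[of 0 "DIM('a) * \<bar>r\<bar>"] continuous_on_subset[OF g(1) subset_UNIV], of "e / 2"])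
           (use \<open>e > 0\<close> in auto)
      have *: "\<bar>g (sin_coords r x) - p (sin_coords r x)\<bar> \<le> e / 2" for x
        using p(2)[of "sin_coords r x"] norm_sin_coords_le[of r x] by simp
      have ps: "integrable P (\<lambda>x. p (sin_coords r x))" "integrable Q (\<lambda>x. p (sin_coords r x))"
          "(\<integral>x. p (sin_coords r x) \<partial>P) = (\<integral>x. p (sin_coords r x) \<partial>Q)"
        using trig[OF trig_polynomial_polynomial_sin_coords[OF p(1)]] by auto
      have close: "\<bar>(\<integral>x. g (sin_coords r x) \<partial>R) - (\<integral>x. p (sin_coords r x) \<partial>R)\<bar> \<le> e / 2"
        if R: "prob_space R" "sets R = sets borel" "integrable R (\<lambda>x. p (sin_coords r x))" for R
      proof -
        interpret R: prob_space R by fact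
        have i: "integrable R (\<lambda>x. g (sin_coords r x))"
          using R gs B by (intro integrable_bounded)
        have "\<bar>\<integral>x. g (sin_coords r x) - p (sin_coords r x) \<partial>R\<bar>
            \<le> (\<integral>x. \<bar>g (sin_coords r x) - p (sin_coords r x)\<bar> \<partial>R)"
          by (rule integral_abs_bound)
        also have "\<dots> \<le> e / 2"
          using i R(3) * by (intro R.integral_le_const) auto
        finally show ?thesis using i R(3) by simp
      qed
      show ?thesis
        using close[OF P ps(1)] close[OF Q ps(2)] ps(3) by linarith
    qed
    then have "\<bar>(\<integral>x. g (sin_coords r x) \<partial>P) - (\<integral>x. g (sin_coords r x) \<partial>Q)\<bar> \<le> 0"
      by (rule field_le_epsilon)
    then show ?thesis by simp
  qed
  have lim: "(\<lambda>n. \<integral>x. g (sin_coords (real n) x) \<partial>R) \<longlonglongrightarrow> integral\<^sup>L R g"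
    if R: "prob_space R" "sets R = sets borel" for R
  proof (rule integral_dominated_convergence[where w = "\<lambda>_. B"])
    interpret R: prob_space R by fact
    show "g \<in> borel_measurable R" "integrable R (\<lambda>_. B)"
      using integrable_bounded[OF R g(1) B] by auto
    show "(\<lambda>x. g (sin_coords (real n) x)) \<in> borel_measurable R" for n
      using integrable_bounded[OF R gs B] by auto
    have "(\<lambda>n. g (sin_coords (real n) x)) \<longlonglongrightarrow> g x" for x
      by (rule continuous_on_tendsto_compose[OF g(1) sin_coords_tendsto]) auto
    then show "AE x in R. (\<lambda>n. g (sin_coords (real n) x)) \<longlonglongrightarrow> g x"
      by simp
  qed (use B in auto)
  show "integral\<^sup>L P g = integral\<^sup>L Q g"
    using lim[OF P] lim[OF Q] unfolding coords_eq by (rule LIMSEQ_unique)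
qed

section \<open>Absolute moments of translates determine a real distribution\<close>

text \<open>The sequence consists of left difference quotients at \<open>t\<close> of
  \<open>s \<mapsto> E |s + X|\<close>. The left derivative of \<open>|s + y|\<close> at
  \<open>t\<close> is 1 if \<open>t + y > 0\<close> and -1 otherwise, so the limit is P(X > -t) -
  P(X \<le> -t).\<close>

lemma abs_moment_tendsto_tail:
  fixes X :: "'a \<Rightarrow> real"
  assumes M: "prob_space M" and X: "integrable M X"
  shows "(\<lambda>n. ((\<integral>\<omega>. \<bar>t + X \<omega>\<bar> \<partial>M) - (\<integral>\<omega>. \<bar>t - inverse (real (Suc n)) + X \<omega>\<bar> \<partial>M)) * real (Suc n))
    \<longlonglongrightarrow> 2 * measure (distr M borel X) {- t<..} - 1"
proof -
  interpret prob_space M by fact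
  have [measurable]: "X \<in> borel_measurable M" using X by auto
  let ?f = "\<lambda>n y. (\<bar>t + y\<bar> - \<bar>t - inverse (real (Suc n)) + y\<bar>) * real (Suc n)"
  have lim: "(\<lambda>n. ?f n y) \<longlonglongrightarrow> 2 * indicator {- t<..} y - 1" for y
  proof (rule tendsto_eventually, cases "t + y > 0")
    case True
    \<comment> \<open>Once the step is shorter than \<open>t + y\<close>, both absolute values have
      positive arguments and the quotient is exactly 1.\<close>
    have ev: "eventually (\<lambda>n. inverse (real (Suc n)) < t + y) sequentially"
      using order_tendstoD(2)[OF LIMSEQ_inverse_real_of_nat True] .
    show "eventually (\<lambda>n. ?f n y = 2 * indicator {- t<..} y - 1) sequentially"
      using ev by eventually_elim (use True in \<open>simp del: of_nat_Suc add: abs_if\<close>)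
  next
    case False
    \<comment> \<open>The kink \<open>t + y = 0\<close> belongs here: moving left from it gives
      slope -1, which is why the half-line in the limit is open.\<close>
    have "\<bar>t + y\<bar> - \<bar>t - inverse (real (Suc n)) + y\<bar> = - inverse (real (Suc n))" for n
    proof -
      have "0 < inverse (real (Suc n))" by simp
      then show ?thesis using False by linarith
    qed
    then show "eventually (\<lambda>n. ?f n y = 2 * indicator {- t<..} y - 1) sequentially"
      using False by (simp del: of_nat_Suc)
  qed
  \<comment> \<open>The absolute value is 1-Lipschitz, so the constant 1 dominates all
    quotients.\<close>
  have bound: "\<bar>?f n y\<bar> \<le> 1" for n y
  proof -
    have "\<bar>?f n y\<bar> = \<bar>\<bar>t + y\<bar> - \<bar>t - inverse (real (Suc n)) + y\<bar>\<bar> * real (Suc n)"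
      by (simp add: abs_mult)
    also have "\<dots> \<le> inverse (real (Suc n)) * real (Suc n)"
    proof (rule mult_right_mono)
      have "0 < inverse (real (Suc n))" by simp
      then show "\<bar>\<bar>t + y\<bar> - \<bar>t - inverse (real (Suc n)) + y\<bar>\<bar> \<le> inverse (real (Suc n))"
        by linarith
    qed simp
    finally show ?thesis by (simp del: of_nat_Suc)
  qed
  have "(\<lambda>n. \<integral>\<omega>. ?f n (X \<omega>) \<partial>M) \<longlonglongrightarrow> (\<integral>\<omega>. 2 * indicator {- t<..} (X \<omega>) - 1 \<partial>M)"
    by (rule integral_dominated_convergence[where w = "\<lambda>_. 1"])
       (use lim bound in \<open>auto simp del: of_nat_Suc\<close>)
  moreover have "(\<integral>\<omega>. ?f n (X \<omega>) \<partial>M) =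
     ((\<integral>\<omega>. \<bar>t + X \<omega>\<bar> \<partial>M) - (\<integral>\<omega>. \<bar>t - inverse (real (Suc n)) + X \<omega>\<bar> \<partial>M)) * real (Suc n)" for n
    using X by simp
  moreover have "(\<integral>\<omega>. 2 * indicator {- t<..} (X \<omega>) - 1 \<partial>M) =
     2 * measure (distr M borel X) {- t<..} - 1"
  proof -
    have "(\<integral>\<omega>. indicator {- t<..} (X \<omega>) \<partial>M) = (\<integral>\<omega>. indicator (X -` {- t<..} \<inter> space M) \<omega> \<partial>M :: real)"
      by (intro Bochner_Integration.integral_cong) (auto simp: indicator_def)
    also have "\<dots> = measure M (X -` {- t<..} \<inter> space M)"
      by simp
    finally have eq: "(\<integral>\<omega>. indicator {- t<..} (X \<omega>) \<partial>M) = measure (distr M borel X) {- t<..}"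
      by (simp add: measure_distr)
    have "integrable M (\<lambda>\<omega>. indicator {- t<..} (X \<omega>) :: real)"
      by (rule integrable_const_bound[of _ 1]) auto
    then show ?thesis using eq by (simp add: prob_space)
  qed
  ultimately show ?thesis by simp
qed

lemma distr_eqI_abs_moment:
  fixes X :: "'a \<Rightarrow> real" and Y :: "'b \<Rightarrow> real"
  assumes M: "prob_space M" and X: "integrable M X" and N: "prob_space N" and Y: "integrable N Y"
    and eq: "\<And>t. (\<integral>\<omega>. \<bar>t + X \<omega>\<bar> \<partial>M) = (\<integral>\<omega>. \<bar>t + Y \<omega>\<bar> \<partial>N)"
  shows "distr M borel X = distr N borel Y"
proof (rule measure_eqI_lessThan)
  interpret X: prob_space "distr M borel X"
    using M X by (intro prob_space.prob_space_distr) auto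
  interpret Y: prob_space "distr N borel Y"
    using N Y by (intro prob_space.prob_space_distr) auto
  fix x
  show "emeasure (distr M borel X) {x<..} < \<infinity>"
    using X.emeasure_finite by (simp add: less_top[symmetric])
  \<comment> \<open>The double negation is the literal instance of the tail limit at
    \<open>t = - x\<close>.\<close>
  have "2 * measure (distr M borel X) {- (- x)<..} - 1 = 2 * measure (distr N borel Y) {- (- x)<..} - 1"
    using abs_moment_tendsto_tail[OF M X, of "- x"] abs_moment_tendsto_tail[OF N Y, of "- x"]
    unfolding eq by (rule LIMSEQ_unique)
  then show "emeasure (distr M borel X) {x<..} = emeasure (distr N borel Y) {x<..}"
    by (simp add: X.emeasure_eq_measure Y.emeasure_eq_measure)
qed simp_all

section \<open>Symmetric vectors and removal of the random sign\<close>

text \<open>The sine is odd, so its expectation vanishes by symmetry and only the cosine term of the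
  addition formula survives.\<close>

lemma integral_cos_symmetric:
  fixes \<xi> :: "'a \<Rightarrow> 'b::euclidean_space"
  assumes M: "prob_space M" and "symmetric_random_vector M \<xi>"
  shows "(\<integral>\<omega>. cos (u \<bullet> \<xi> \<omega> + c) \<partial>M) = cos c * (\<integral>\<omega>. cos (u \<bullet> \<xi> \<omega>) \<partial>M)"
proof -
  interpret prob_space M by fact
  have [measurable]: "\<xi> \<in> borel_measurable M"
    and sym: "distr M borel \<xi> = distr M borel (\<lambda>\<omega>. - \<xi> \<omega>)"
    using assms(2) by (auto simp: symmetric_random_vector_def)
  have "(\<integral>\<omega>. sin (u \<bullet> \<xi> \<omega>) \<partial>M) = (\<integral>x. sin (u \<bullet> x) \<partial>distr M borel \<xi>)"
    by (subst integral_distr) auto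
  also have "\<dots> = (\<integral>\<omega>. sin (u \<bullet> - \<xi> \<omega>) \<partial>M)"
    unfolding sym by (subst integral_distr) auto
  finally have "(\<integral>\<omega>. sin (u \<bullet> \<xi> \<omega>) \<partial>M) = 0"
    by simp
  moreover have "integrable M (\<lambda>\<omega>. sin (u \<bullet> \<xi> \<omega>))" "integrable M (\<lambda>\<omega>. cos (u \<bullet> \<xi> \<omega>))"
    by (auto intro!: integrable_const_bound[of _ 1])
  ultimately show ?thesis
    by (simp add: cos_add)
qed

text \<open>Since \<open>e * e = 1\<close>, the left side is \<open>|e| * |s + e * y|\<close>. This
  moves the sign from the deterministic term to the random one.\<close>

lemma abs_sign_mult_add:
  fixes e s y :: real
  assumes "e \<in> {-1, 1}"
  shows "\<bar>s * e + y\<bar> = \<bar>s + e * y\<bar>"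
  using assms by auto

theorem theorem8:
  fixes M :: "'a measure" and N :: "'b measure"
    and \<xi> :: "'a \<Rightarrow> real ^ 'd" and \<xi>' :: "'b \<Rightarrow> real ^ 'd"
    and \<epsilon> :: "'a \<Rightarrow> real" and \<epsilon>' :: "'b \<Rightarrow> real"
  assumes "prob_space M" and "prob_space N"
    and "symmetric_random_vector M \<xi>" and "symmetric_random_vector N \<xi>'"
    and "integrable M \<xi>" and "integrable N \<xi>'"
    and "\<not> (AE \<omega> in M. \<xi> \<omega> = 0)" and "\<not> (AE \<omega> in N. \<xi>' \<omega> = 0)"
    and "\<epsilon> \<in> borel_measurable M" and "\<epsilon>' \<in> borel_measurable N"
    and "\<forall>\<omega>\<in>space M. \<epsilon> \<omega> \<in> {-1, 1}" and "\<forall>\<omega>\<in>space N. \<epsilon>' \<omega> \<in> {-1, 1}"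
    and "\<forall>(u0 :: real) (u :: real ^ 'd).
           prob_space.expectation M (\<lambda>\<omega>. \<bar>u0 * \<epsilon> \<omega> + u \<bullet> \<xi> \<omega>\<bar>) =
           prob_space.expectation N (\<lambda>\<omega>. \<bar>u0 * \<epsilon>' \<omega> + u \<bullet> \<xi>' \<omega>\<bar>)"
  shows "distr M borel \<xi> = distr N borel \<xi>'"
proof -
  interpret M: prob_space M by fact
  interpret N: prob_space N by fact
  have [measurable]: "\<xi> \<in> borel_measurable M" "\<xi>' \<in> borel_measurable N"
      "\<epsilon> \<in> borel_measurable M" "\<epsilon>' \<in> borel_measurable N"
    using assms by (auto simp: symmetric_random_vector_def)
  have intM: "integrable M (\<lambda>\<omega>. \<epsilon> \<omega> * (u \<bullet> \<xi> \<omega>))" for u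
    by (rule Bochner_Integration.integrable_bound[of _ "\<lambda>\<omega>. u \<bullet> \<xi> \<omega>"])
       (use assms in \<open>auto intro!: AE_I2 simp: abs_mult\<close>)
  have intN: "integrable N (\<lambda>\<omega>. \<epsilon>' \<omega> * (u \<bullet> \<xi>' \<omega>))" for u
    by (rule Bochner_Integration.integrable_bound[of _ "\<lambda>\<omega>. u \<bullet> \<xi>' \<omega>"])
       (use assms in \<open>auto intro!: AE_I2 simp: abs_mult\<close>)
  \<comment> \<open>The hypothesis gives the law of the signed product, which may differ from that
    of \<open>u \<bullet> \<xi> \<omega>\<close> because the sign may depend on
    \<open>\<xi>\<close>. The cosine is even, so its expectation does not see the sign.\<close>
  have cos_eq: "(\<integral>\<omega>. cos (u \<bullet> \<xi> \<omega>) \<partial>M) = (\<integral>\<omega>. cos (u \<bullet> \<xi>' \<omega>) \<partial>N)" for u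
  proof -
    have distr: "distr M borel (\<lambda>\<omega>. \<epsilon> \<omega> * (u \<bullet> \<xi> \<omega>)) = distr N borel (\<lambda>\<omega>. \<epsilon>' \<omega> * (u \<bullet> \<xi>' \<omega>))"
    proof (rule distr_eqI_abs_moment[OF assms(1) intM assms(2) intN])
      fix t
      have "(\<integral>\<omega>. \<bar>t + \<epsilon> \<omega> * (u \<bullet> \<xi> \<omega>)\<bar> \<partial>M) = (\<integral>\<omega>. \<bar>t * \<epsilon> \<omega> + u \<bullet> \<xi> \<omega>\<bar> \<partial>M)"
        using assms(11) by (intro Bochner_Integration.integral_cong abs_sign_mult_add[symmetric]) auto
      also have "\<dots> = (\<integral>\<omega>. \<bar>t * \<epsilon>' \<omega> + u \<bullet> \<xi>' \<omega>\<bar> \<partial>N)"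
        using assms(13) by blast
      also have "\<dots> = (\<integral>\<omega>. \<bar>t + \<epsilon>' \<omega> * (u \<bullet> \<xi>' \<omega>)\<bar> \<partial>N)"
        using assms(12) by (intro Bochner_Integration.integral_cong abs_sign_mult_add) auto
      finally show "(\<integral>\<omega>. \<bar>t + \<epsilon> \<omega> * (u \<bullet> \<xi> \<omega>)\<bar> \<partial>M) = (\<integral>\<omega>. \<bar>t + \<epsilon>' \<omega> * (u \<bullet> \<xi>' \<omega>)\<bar> \<partial>N)" .
    qed
    have "(\<integral>\<omega>. cos (u \<bullet> \<xi> \<omega>) \<partial>M) = (\<integral>\<omega>. cos (\<epsilon> \<omega> * (u \<bullet> \<xi> \<omega>)) \<partial>M)"
      using assms(11) by (intro Bochner_Integration.integral_cong) auto
    also have "\<dots> = (\<integral>y. cos y \<partial>distr M borel (\<lambda>\<omega>. \<epsilon> \<omega> * (u \<bullet> \<xi> \<omega>)))"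
      by (subst integral_distr) auto
    also have "\<dots> = (\<integral>\<omega>. cos (\<epsilon>' \<omega> * (u \<bullet> \<xi>' \<omega>)) \<partial>N)"
      unfolding distr by (subst integral_distr) auto
    also have "\<dots> = (\<integral>\<omega>. cos (u \<bullet> \<xi>' \<omega>) \<partial>N)"
      using assms(12) by (intro Bochner_Integration.integral_cong) auto
    finally show ?thesis .
  qed
  show ?thesis
  proof (rule measure_eqI_integral_cos)
    show "prob_space (distr M borel \<xi>)" "prob_space (distr N borel \<xi>')"
      by (auto intro: M.prob_space_distr N.prob_space_distr)
    fix u :: "real ^ 'd" and c :: real
    have "(\<integral>x. cos (u \<bullet> x + c) \<partial>distr M borel \<xi>) = (\<integral>\<omega>. cos (u \<bullet> \<xi> \<omega> + c) \<partial>M)"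
      by (subst integral_distr) auto
    \<comment> \<open>Symmetry of both vectors reduces an arbitrary phase \<open>c\<close> to
      \<open>cos_eq\<close>, the case of phase 0.\<close>
    also have "\<dots> = (\<integral>\<omega>. cos (u \<bullet> \<xi>' \<omega> + c) \<partial>N)"
      using assms(1-4) cos_eq by (simp add: integral_cos_symmetric)
    also have "\<dots> = (\<integral>x. cos (u \<bullet> x + c) \<partial>distr N borel \<xi>')"
      by (subst integral_distr) auto
    finally show "(\<integral>x. cos (u \<bullet> x + c) \<partial>distr M borel \<xi>) = (\<integral>x. cos (u \<bullet> x + c) \<partial>distr N borel \<xi>')" .
  qed simp_all
qed

end
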